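(* Let $n\geq3$ and let $F$ be an analytic function defined in a neighbourhood of $0\in\mathbb{C}$ such that $F(0)=F'(0)=F''(0)=\dots=F^{(n-1)}(0)=0$ and $F^{(n)}(0)\neq0$. Let $K$ be the Gaussian curvature of the modular surface in $\mathbb{E}_1^3$ induced by $F$. Then $K(0)$ is undefined, but in a deleted neighbourhood of $z=0$ the Gaussian curvature $K$ is negative.
   Context: $\mathbb{E}_1^3$ denotes $\mathbb{R}^3$ with the Lorentzian metric $dx^2+dy^2-dt^2$; $(x,y)$ is identified with $z=x+iy$. The modular surface induced by an analytic function $F$ is the graph $(x,y,h(x,y))$ with $h=|F|$. Its Gaussian curvature in $\mathbb{E}_1^3$, as a function of $z$, is $$K=-\frac{h_{xx}h_{yy}-h_{xy}^2}{(1-h_x^2-h_y^2)^2},$$ which where $F\neq0$ and $|F'|\neq1$ equals $-\dfrac{|F'|^4-|2FF''-(F')^2|^2}{4|F|^2(1-|F'|^2)^2}$; "$K(0)$ is undefined" is asserted in the sense that this last formula is not defined at a point where $F=0$. $F$ is not required to be the square of an analytic function. $F^{(k)}$ denotes the $k$-th complex derivative. *)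

theory Defs
  imports "HOL-Complex_Analysis.Complex_Analysis"
begin

definition partial_x :: "(real \<Rightarrow> real \<Rightarrow> real) \<Rightarrow> real \<Rightarrow> real \<Rightarrow> real"
  where "partial_x h x y = deriv (\<lambda>s. h s y) x"

definition partial_y :: "(real \<Rightarrow> real \<Rightarrow> real) \<Rightarrow> real \<Rightarrow> real \<Rightarrow> real"
  where "partial_y h x y = deriv (\<lambda>t. h x t) y"

definition twice_differentiable_at :: "(real \<Rightarrow> real \<Rightarrow> real) \<Rightarrow> real \<Rightarrow> real \<Rightarrow> bool"
  where "twice_differentiable_at h x y \<longleftrightarrow>
    (\<forall>\<^sub>F p in nhds (x, y). case_prod h differentiable (at p)) \<and>
    case_prod (partial_x h) differentiable (at (x, y)) \<and>
    case_prod (partial_y h) differentiable (at (x, y))"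

text \<open>The Gaussian curvature at \<open>(x, y, h x y)\<close> of the graph of \<open>h\<close> for the metric
  \<open>dx\<^sup>2 + dy\<^sup>2 - dt\<^sup>2\<close>. It is \<open>None\<close> where \<open>h\<close> is not twice differentiable (in the Frechet
  sense, so that no unspecified value of \<open>deriv\<close> enters) or where the induced metric, whose
  determinant is \<open>1 - h\<^sub>x\<^sup>2 - h\<^sub>y\<^sup>2\<close>, is degenerate.\<close>

definition lorentz_graph_curvature ::
    "(real \<Rightarrow> real \<Rightarrow> real) \<Rightarrow> real \<Rightarrow> real \<Rightarrow> real option"
  where "lorentz_graph_curvature h x y =
    (let hx = partial_x h x y; hy = partial_y h x y;
         hxx = partial_x (partial_x h) x y;
         hxy = partial_y (partial_x h) x y;
         hyy = partial_y (partial_y h) x y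
     in if twice_differentiable_at h x y \<and> 1 - hx\<^sup>2 - hy\<^sup>2 \<noteq> 0
        then Some (- ((hxx * hyy - hxy\<^sup>2) / (1 - hx\<^sup>2 - hy\<^sup>2)\<^sup>2))
        else None)"

definition modular_height :: "(complex \<Rightarrow> complex) \<Rightarrow> real \<Rightarrow> real \<Rightarrow> real"
  where "modular_height F x y = cmod (F (Complex x y))"

definition modular_curvature :: "(complex \<Rightarrow> complex) \<Rightarrow> complex \<Rightarrow> real option"
  where "modular_curvature F z = lorentz_graph_curvature (modular_height F) (Re z) (Im z)"

text \<open>The curvature of the modular surface written in terms of \<open>F\<close> and its complex derivatives,
  with \<open>None\<close> where the denominator of the quotient vanishes. Its domain is smaller than that of
  \<open>modular_curvature\<close>: where \<open>F\<close> has a zero of order at least 3, \<open>modular_height F\<close> is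
  still twice differentiable and \<open>modular_curvature F\<close> takes the value 0, whereas the quotient
  is not defined.\<close>

definition modular_curvature_quotient :: "(complex \<Rightarrow> complex) \<Rightarrow> complex \<Rightarrow> real option"
  where "modular_curvature_quotient F z =
    (let F0 = F z; F1 = deriv F z; F2 = (deriv ^^ 2) F z;
         d = 4 * (cmod F0)\<^sup>2 * (1 - (cmod F1)\<^sup>2)\<^sup>2
     in if d = 0 then None
        else Some (- (((cmod F1) ^ 4 - (cmod (2 * F0 * F2 - F1\<^sup>2))\<^sup>2) / d)))"

lemma partials_eq:
  assumes "(case_prod g has_derivative D) (at (x, y))"
  shows "partial_x g x y = D (1, 0)" and "partial_y g x y = D (0, 1)"
proof -
  have lin: "linear D" using assms has_derivative_linear by blast
  have "((\<lambda>s. case_prod g (s, y)) has_derivative (\<lambda>v. D (v, 0))) (at x)"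
    using has_derivative_compose[of "\<lambda>s. (s, y)" "\<lambda>v. (v, 0)" x UNIV "case_prod g" D] assms
    by (simp add: has_derivative_Pair)
  moreover have "(\<lambda>v. D (v, 0)) = (*) (D (1, 0))"
  proof (rule ext)
    fix v :: real
    have "D (v, 0) = D (v *\<^sub>R (1, 0))" by simp
    also have "\<dots> = v *\<^sub>R D (1, 0)" by (rule linear_scale[OF lin])
    finally show "D (v, 0) = D (1, 0) * v" by simp
  qed
  ultimately show "partial_x g x y = D (1, 0)"
    unfolding partial_x_def by (intro DERIV_imp_deriv) (simp add: has_field_derivative_def)
  have "((\<lambda>t. case_prod g (x, t)) has_derivative (\<lambda>v. D (0, v))) (at y)"
    using has_derivative_compose[of "\<lambda>s. (x, s)" "\<lambda>v. (0, v)" y UNIV "case_prod g" D] assms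
    by (simp add: has_derivative_Pair)
  moreover have "(\<lambda>v. D (0, v)) = (*) (D (0, 1))"
  proof (rule ext)
    fix v :: real
    have "D (0, v) = D (v *\<^sub>R (0, 1))" by simp
    also have "\<dots> = v *\<^sub>R D (0, 1)" by (rule linear_scale[OF lin])
    finally show "D (0, v) = D (0, 1) * v" by simp
  qed
  ultimately show "partial_y g x y = D (0, 1)"
    unfolding partial_y_def by (intro DERIV_imp_deriv) (simp add: has_field_derivative_def)
qed

lemma has_derivative_Complex_comp:
  assumes "(G has_field_derivative G') (at (Complex x y))"
  shows "((\<lambda>p. G (Complex (fst p) (snd p))) has_derivative (\<lambda>v. G' * Complex (fst v) (snd v))) (at (x, y))"
proof -
  have "((\<lambda>p. Complex (fst p) (snd p)) has_derivative (\<lambda>v. Complex (fst v) (snd v))) (at (x, y))"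
    unfolding Complex_eq by (auto intro!: derivative_eq_intros)
  from has_derivative_compose[OF this, of G "\<lambda>v. G' * v"] assms
  show ?thesis by (simp add: has_field_derivative_def)
qed

lemma curvature_algebra:
  fixes u v a b c d :: real
  assumes "u\<^sup>2 + v\<^sup>2 = h\<^sup>2" "h \<noteq> 0"
  defines "A \<equiv> u * a + v * b" and "B \<equiv> v * a - u * b" and "s \<equiv> a\<^sup>2 + b\<^sup>2"
    and "p \<equiv> u * c + v * d" and "q \<equiv> u * d - v * c"
  shows "4 * h\<^sup>2 * (((s + p) / h - A * A / h^3) * ((s - p) / h - B * B / h^3) - (- q / h - A * B / h^3)\<^sup>2)
     = s\<^sup>2 - ((2 * (u * c - v * d) - (a\<^sup>2 - b\<^sup>2))\<^sup>2 + (2 * (u * d + v * c) - 2 * a * b)\<^sup>2)"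
proof -
  have AB: "A\<^sup>2 + B\<^sup>2 = h\<^sup>2 * s"
    unfolding A_def B_def s_def assms(1)[symmetric] by algebra
  have pq: "p\<^sup>2 + q\<^sup>2 = h\<^sup>2 * (c\<^sup>2 + d\<^sup>2)"
    unfolding p_def q_def assms(1)[symmetric] by algebra
  have x: "p * (A\<^sup>2 - B\<^sup>2) - 2 * q * A * B = h\<^sup>2 * ((u * c - v * d) * (a\<^sup>2 - b\<^sup>2) + 2 * a * b * (u * d + v * c))"
    unfolding p_def q_def A_def B_def assms(1)[symmetric] by algebra
  have e1: "h\<^sup>2 * ((s + p) / h - A * A / h^3) * ((s - p) / h - B * B / h^3)
     = (s + p - A\<^sup>2 / h\<^sup>2) * (s - p - B\<^sup>2 / h\<^sup>2)"
    using assms(2) by (simp add: field_simps power2_eq_square power3_eq_cube)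
  have e2: "h\<^sup>2 * (- q / h - A * B / h^3)\<^sup>2 = (q + A * B / h\<^sup>2)\<^sup>2"
    using assms(2) by (simp add: field_simps power2_eq_square power3_eq_cube)
  have gen: "4 * k * (P * Q - R) = 4 * (k * P * Q - k * R)" for k P Q R :: real
    by (simp add: algebra_simps)
  have "4 * h\<^sup>2 * (((s + p) / h - A * A / h^3) * ((s - p) / h - B * B / h^3) - (- q / h - A * B / h^3)\<^sup>2)
    = 4 * ((s + p - A\<^sup>2 / h\<^sup>2) * (s - p - B\<^sup>2 / h\<^sup>2) - (q + A * B / h\<^sup>2)\<^sup>2)"
    unfolding gen e1 e2 ..
  also have "\<dots> = 4 * (s\<^sup>2 - (p\<^sup>2 + q\<^sup>2) - s * (A\<^sup>2 + B\<^sup>2) / h\<^sup>2 + (p * (A\<^sup>2 - B\<^sup>2) - 2 * q * A * B) / h\<^sup>2)"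
    using assms(2) by (simp add: field_simps power2_eq_square)
  also have "\<dots> = 4 * (- h\<^sup>2 * (c\<^sup>2 + d\<^sup>2) + ((u * c - v * d) * (a\<^sup>2 - b\<^sup>2) + 2 * a * b * (u * d + v * c)))"
    unfolding AB pq x using assms(2) by (simp add: power2_eq_square)
  also have "\<dots> = s\<^sup>2 - ((2 * (u * c - v * d) - (a\<^sup>2 - b\<^sup>2))\<^sup>2 + (2 * (u * d + v * c) - 2 * a * b)\<^sup>2)"
    unfolding s_def assms(1)[symmetric] by algebra
  finally show ?thesis .
qed

lemma modular_curvature_eq_quotient:
  assumes "F analytic_on {z}" and "F z \<noteq> 0" and "cmod (deriv F z) \<noteq> 1"
  shows "modular_curvature F z = modular_curvature_quotient F z"
proof -
  obtain e where e: "e > 0" "F holomorphic_on ball z e"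
    using assms(1) by (auto simp: analytic_on_def)
  obtain r where r: "r > 0" "\<And>w. dist z w < r \<Longrightarrow> F w \<noteq> 0"
    using continuous_at_avoid[of z F 0] e assms(2) 
    by (metis analytic_at_imp_isCont assms(1))
  define W where "W = ball z (min e r)"
  have W: "open W" "z \<in> W" "F holomorphic_on W" "\<And>w. w \<in> W \<Longrightarrow> F w \<noteq> 0"
    using e r by (auto simp: W_def intro: holomorphic_on_subset)
  define V where "V = (\<lambda>p. Complex (fst p) (snd p)) -` W"
  have contC: "continuous_on UNIV (\<lambda>p. Complex (fst p) (snd p))"
    unfolding Complex_eq by (intro continuous_intros)
  have V: "open V" unfolding V_def by (rule open_vimage[OF W(1) contC])
  have zV: "(Re z, Im z) \<in> V" using W(2) by (simp add: V_def)
  define c where "c = (\<lambda>p. Complex (fst p) (snd p))"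
  have cv: "c p \<in> W" if "p \<in> V" for p using that by (simp add: V_def c_def)
  have cz: "c (Re z, Im z) = z" by (simp add: c_def)
  let ?h = "modular_height F"
  have D1: "((\<lambda>p. F (c p)) has_derivative (\<lambda>v. deriv F (c p) * c v)) (at p)" if "p \<in> V" for p
    using has_derivative_Complex_comp[of F "deriv F (c p)" "fst p" "snd p"]
      holomorphic_derivI[OF W(3) W(1) cv[OF that]] by (simp add: c_def)
  have D2: "((\<lambda>p. deriv F (c p)) has_derivative (\<lambda>v. (deriv ^^ 2) F (c p) * c v)) (at p)" if "p \<in> V" for p
    using has_derivative_Complex_comp[of "deriv F" "(deriv ^^ 2) F (c p)" "fst p" "snd p"]
      holomorphic_derivI[OF holomorphic_deriv[OF W(3) W(1)] W(1) cv[OF that]]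
    by (simp add: c_def numeral_2_eq_2)
  have hh: "case_prod ?h = (\<lambda>p. norm (F (c p)))"
    by (auto simp: modular_height_def c_def)
  have Dh: "(case_prod ?h has_derivative (\<lambda>v. inner (F (c p)) (deriv F (c p) * c v) / norm (F (c p)))) (at p)"
    if "p \<in> V" for p
  proof -
    have "((\<lambda>p. norm (F (c p))) has_derivative (\<lambda>v. inner (sgn (F (c p))) (deriv F (c p) * c v))) (at p)"
      using has_derivative_compose[OF D1[OF that] has_derivative_norm[of "F (c p)"]]
        W(4)[OF cv[OF that]] by (simp add: inner_commute)
    then show ?thesis unfolding hh by (simp add: sgn_div_norm divide_inverse mult.commute)
  qed
  define X where "X = (\<lambda>p. inner (F (c p)) (deriv F (c p)) / norm (F (c p)))"
  define Y where "Y = (\<lambda>p. inner (F (c p)) (deriv F (c p) * \<i>) / norm (F (c p)))"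
  have c10: "c (1,0) = 1" "c (0,1) = \<i>" by (auto simp: c_def complex_eq_iff)
  have px: "case_prod (partial_x ?h) p = X p" and py: "case_prod (partial_y ?h) p = Y p"
    if "p \<in> V" for p
    using partials_eq[of ?h _ "fst p" "snd p"] Dh[OF that]
    by (auto simp: X_def Y_def c10 split: prod.splits)
  let ?p = "(Re z, Im z)"
  let ?f = "F z" and ?f1 = "deriv F z" and ?f2 = "(deriv ^^ 2) F z"
  define n where "n = norm ?f"
  have n: "n \<noteq> 0" using assms(2) by (simp add: n_def)
  have Dn: "((\<lambda>p. norm (F (c p))) has_derivative (\<lambda>v. inner ?f (?f1 * c v) / n)) (at ?p)"
    using Dh[OF zV] by (simp add: hh cz n_def)
  define DX where "DX = (\<lambda>v. (inner ?f (?f2 * c v) + inner (?f1 * c v) ?f1) / n - inner ?f ?f1 * inner ?f (?f1 * c v) / n ^ 3)"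
  define DY where "DY = (\<lambda>v. (inner ?f (?f2 * c v * \<i>) + inner (?f1 * c v) (?f1 * \<i>)) / n - inner ?f (?f1 * \<i>) * inner ?f (?f1 * c v) / n ^ 3)"
  have "(X has_derivative DX) (at ?p)"
    unfolding X_def
    by (rule derivative_eq_intros D1[OF zV] D2[OF zV] Dn refl)+
       (use n in \<open>auto simp: DX_def cz n_def[symmetric] fun_eq_iff field_simps power3_eq_cube power2_eq_square\<close>)
  then have DXp: "(case_prod (partial_x ?h) has_derivative DX) (at ?p)"
    by (rule has_derivative_transform_within_open[OF _ V zV]) (simp add: px)
  have "(Y has_derivative DY) (at ?p)"
    unfolding Y_def
    by (rule derivative_eq_intros D1[OF zV] D2[OF zV] Dn refl)+
       (use n in \<open>auto simp: DY_def cz n_def[symmetric] fun_eq_iff field_simps power3_eq_cube power2_eq_square\<close>)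
  then have DYp: "(case_prod (partial_y ?h) has_derivative DY) (at ?p)"
    by (rule has_derivative_transform_within_open[OF _ V zV]) (simp add: py)
  have "\<forall>\<^sub>F p in nhds ?p. case_prod ?h differentiable (at p)"
    using Dh V zV unfolding eventually_nhds differentiable_def by blast
  then have tw: "twice_differentiable_at ?h (Re z) (Im z)"
    using DXp DYp unfolding twice_differentiable_at_def differentiable_def by blast
  define u v a b c' d where "u = Re ?f" "v = Im ?f" "a = Re ?f1" "b = Im ?f1" "c' = Re ?f2" "d = Im ?f2"
  note defs = this
  have n2: "u\<^sup>2 + v\<^sup>2 = n\<^sup>2" by (simp add: n_def defs cmod_def)
  have f: "?f = Complex u v" "?f1 = Complex a b" "?f2 = Complex c' d" by (simp_all add: defs)
  have hx: "partial_x ?h (Re z) (Im z) = (u * a + v * b) / n"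
    using px[OF zV] by (simp add: X_def cz n_def inner_complex_def defs)
  have hy: "partial_y ?h (Re z) (Im z) = (v * a - u * b) / n"
    using py[OF zV] by (simp add: Y_def cz n_def inner_complex_def defs)
  have hxx: "partial_x (partial_x ?h) (Re z) (Im z)
     = ((a\<^sup>2 + b\<^sup>2) + (u * c' + v * d)) / n - (u * a + v * b) * (u * a + v * b) / n^3"
    unfolding partials_eq(1)[OF DXp] DX_def c10
    by (simp add: inner_complex_def f power2_eq_square algebra_simps)
  have hxy: "partial_y (partial_x ?h) (Re z) (Im z)
     = - (u * d - v * c') / n - (u * a + v * b) * (v * a - u * b) / n^3"
    unfolding partials_eq(2)[OF DXp] DX_def c10
    by (simp add: inner_complex_def f power2_eq_square algebra_simps)
  have hyy: "partial_y (partial_y ?h) (Re z) (Im z)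
     = ((a\<^sup>2 + b\<^sup>2) - (u * c' + v * d)) / n - (v * a - u * b) * (v * a - u * b) / n^3"
    unfolding partials_eq(2)[OF DYp] DY_def c10
    by (simp add: inner_complex_def f power2_eq_square algebra_simps)
  have s: "(cmod ?f1)\<^sup>2 = a\<^sup>2 + b\<^sup>2" by (simp add: f cmod_def)
  have "((u * a + v * b) / n)\<^sup>2 + ((v * a - u * b) / n)\<^sup>2 = ((u\<^sup>2 + v\<^sup>2) * (a\<^sup>2 + b\<^sup>2)) / n\<^sup>2"
    by (simp add: power_divide add_divide_distrib[symmetric]) (simp add: power2_eq_square algebra_simps)
  then have den: "1 - ((u * a + v * b) / n)\<^sup>2 - ((v * a - u * b) / n)\<^sup>2 = 1 - (cmod ?f1)\<^sup>2"
    using n by (simp add: n2 s)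
  have den0: "1 - (cmod ?f1)\<^sup>2 \<noteq> 0"
    using assms(3) by (smt (verit) norm_ge_zero power2_eq_1_iff)
  define H where "H = (((a\<^sup>2 + b\<^sup>2) + (u * c' + v * d)) / n - (u * a + v * b) * (u * a + v * b) / n^3)
     * (((a\<^sup>2 + b\<^sup>2) - (u * c' + v * d)) / n - (v * a - u * b) * (v * a - u * b) / n^3)
     - (- (u * d - v * c') / n - (u * a + v * b) * (v * a - u * b) / n^3)\<^sup>2"
  have num: "4 * n\<^sup>2 * H = (cmod ?f1) ^ 4 - (cmod (2 * ?f * ?f2 - ?f1\<^sup>2))\<^sup>2"
  proof -
    have "(cmod ?f1) ^ 4 = (a\<^sup>2 + b\<^sup>2)\<^sup>2" using s by (metis power4_eq_xxxx power2_eq_square mult.assoc)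
    moreover have "(cmod (2 * ?f * ?f2 - ?f1\<^sup>2))\<^sup>2 =
       (2 * (u * c' - v * d) - (a\<^sup>2 - b\<^sup>2))\<^sup>2 + (2 * (u * d + v * c') - 2 * a * b)\<^sup>2"
      unfolding cmod_power2 f by (simp add: power2_eq_square algebra_simps)
    ultimately show ?thesis
      using curvature_algebra[OF n2 n, of a b c' d] by (simp add: H_def)
  qed
  have "modular_curvature F z = Some (- (H / (1 - (cmod ?f1)\<^sup>2)\<^sup>2))"
    unfolding modular_curvature_def lorentz_graph_curvature_def Let_def hx hy hxx hxy hyy den
    using tw den0 by (simp add: H_def)
  also have "\<dots> = modular_curvature_quotient F z"
    unfolding modular_curvature_quotient_def Let_def num[symmetric] n_def[symmetric]
    using n den0 by (simp add: mult_divide_mult_cancel_left)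
  finally show ?thesis .
qed

end

theory Submission
  imports Defs
begin

text \<open>
  Away from the zeros of \<open>F\<close> and the points with \<open>\<bar>F'\<bar> = 1\<close>, the curvature is negative
  exactly when \<open>\<bar>2 F F'' - F'\<^sup>2\<bar> < \<bar>F'\<bar>\<^sup>2\<close>. For the monomial \<open>F = z\<^sup>n\<close> the two sides are
  \<open>n (n - 2)\<close> and \<open>n\<^sup>2\<close> times the same power of \<open>\<bar>z\<bar>\<close>, so the inequality is
  strict at every \<open>z \<noteq> 0\<close>.

  A function with a zero of order \<open>n\<close> is a perturbation of this case. Writing \<open>F = z\<^sup>n g\<close> with
  \<open>g 0 \<noteq> 0\<close>, and factoring \<open>F'\<close> and \<open>F''\<close> accordingly (\<open>deriv_power_factor\<close>), the same power of
  \<open>\<bar>z\<bar>\<close> cancels from both sides. What remains is an inequality between functions continuous at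
  \<open>0\<close>, whose values there are \<open>n (n - 2) \<bar>g 0\<bar>\<^sup>2\<close> and \<open>n\<^sup>2 \<bar>g 0\<bar>\<^sup>2\<close>; hence it persists nearby
  (\<open>eventually_hessian_less_at_zero\<close>). Since \<open>F'\<close> vanishes at \<open>0\<close> as well, \<open>\<bar>F'\<bar> < 1\<close> near
  \<open>0\<close>, and the induced metric does not degenerate there.
\<close>

lemma deriv_power_factor:
  fixes F g :: "complex \<Rightarrow> complex"
  assumes "open S" and "g holomorphic_on S" and w: "w \<in> S"
    and F: "\<And>w. w \<in> S \<Longrightarrow> F w = (w - a) ^ Suc m * g w"
  shows "deriv F w = (w - a) ^ m * (of_nat (Suc m) * g w + (w - a) * deriv g w)"
proof -
  have g: "(g has_field_derivative deriv g w) (at w)"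
    using holomorphic_derivI[OF assms(2,1) w] .
  have "((\<lambda>w. (w - a) ^ Suc m * g w) has_field_derivative
      (w - a) ^ m * (of_nat (Suc m) * g w + (w - a) * deriv g w)) (at w)"
    by (rule derivative_eq_intros g refl | simp add: algebra_simps)+
  then have "(F has_field_derivative
      (w - a) ^ m * (of_nat (Suc m) * g w + (w - a) * deriv g w)) (at w)"
    by (rule has_field_derivative_transform_within_open[OF _ assms(1) w]) (simp add: F)
  then show ?thesis by (rule DERIV_imp_deriv)
qed

text \<open>
  The leading coefficients of \<open>F'\<^sup>2\<close> and \<open>2 F F'' - F'\<^sup>2\<close> at the zero are \<open>n\<^sup>2\<close> and
  \<open>2 n (n - 1) - n\<^sup>2 = n (n - 2)\<close> times a common nonzero number, and the second is the smaller one.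
  Order at least 2 makes \<open>n - 2\<close> nonnegative, and makes \<open>F'\<close> vanish at \<open>a\<close>.
\<close>

lemma eventually_hessian_less_at_zero:
  fixes F :: "complex \<Rightarrow> complex"
  assumes "F analytic_on {a}" and n: "n \<ge> 2"
    and zero: "\<And>k. k < n \<Longrightarrow> (deriv ^^ k) F a = 0" and nz: "(deriv ^^ n) F a \<noteq> 0"
  shows "\<forall>\<^sub>F z in at a. F z \<noteq> 0 \<and> cmod (deriv F z) < 1 \<and>
    cmod (2 * F z * (deriv ^^ 2) F z - (deriv F z)\<^sup>2) < (cmod (deriv F z))\<^sup>2"
proof -
  obtain e where e: "e > 0" "F holomorphic_on ball a e"
    using assms(1) by (auto simp: analytic_on_def)
  have "F a = 0" using zero[of 0] n by simp
  then obtain g r where r: "r > 0" "g holomorphic_on ball a r"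
    and Fg: "\<And>w. w \<in> ball a r \<Longrightarrow> F w = (w - a) ^ n * g w"
    and g0: "\<And>w. w \<in> ball a r \<Longrightarrow> g w \<noteq> 0"
    using holomorphic_factor_order_of_zero[OF e(2) open_ball, of a n] e(1) n nz zero
    by (smt (verit, best) centre_in_ball diff_zero not_numeral_le_zero gr0I)
  obtain m where m: "n = Suc (Suc m)" using n by (metis add_2_eq_Suc le_Suc_ex)
  define g1 where "g1 = (\<lambda>w. of_nat (Suc (Suc m)) * g w + (w - a) * deriv g w)"
  define g2 where "g2 = (\<lambda>w. of_nat (Suc m) * g1 w + (w - a) * deriv g1 w)"
  have hol1: "g1 holomorphic_on ball a r" and hol2: "g2 holomorphic_on ball a r"
    unfolding g2_def g1_def by (intro holomorphic_intros r open_ball)+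
  have F1: "deriv F w = (w - a) ^ Suc m * g1 w" if "w \<in> ball a r" for w
    unfolding g1_def using r that Fg m by (intro deriv_power_factor[of "ball a r"]) auto
  have F2: "(deriv ^^ 2) F w = (w - a) ^ m * g2 w" if "w \<in> ball a r" for w
    unfolding g2_def using deriv_power_factor[OF open_ball hol1 that F1]
    by (simp add: numeral_2_eq_2)
  have cont: "isCont h a" if "h holomorphic_on ball a r" for h
    using that r(1) by (meson centre_in_ball continuous_on_eq_continuous_at
        holomorphic_on_imp_continuous_on open_ball)
  have ga: "g a \<noteq> 0" using g0 r(1) by simp
  define D where "D = (\<lambda>w. (cmod (g1 w))\<^sup>2 - cmod (2 * g w * g2 w - (g1 w)\<^sup>2))"
  have "isCont D a"
    unfolding D_def using cont[OF hol1] cont[OF hol2] cont[OF r(2)] by (intro continuous_intros)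
  moreover have "D a > 0"
  proof -
    have "2 * g a * g2 a - (g1 a)\<^sup>2 = of_nat (n * m) * (g a)\<^sup>2"
      by (simp add: g2_def g1_def m algebra_simps power2_eq_square)
    then have "cmod (2 * g a * g2 a - (g1 a)\<^sup>2) = (real n * real m) * (cmod (g a))\<^sup>2"
      by (simp add: norm_mult norm_power del: of_nat_mult) simp
    moreover have "(cmod (g1 a))\<^sup>2 = (real n * real n) * (cmod (g a))\<^sup>2"
      by (simp add: g1_def m[symmetric] norm_mult power2_eq_square del: of_nat_Suc)
    moreover have "real n * real m < real n * real n" using m by simp
    ultimately show ?thesis
      using mult_strict_right_mono[of _ _ "(cmod (g a))\<^sup>2"] ga
      unfolding D_def by (simp only: diff_gt_0_iff_gt zero_less_power2 norm_eq_zero not_False_eq_True)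
  qed
  ultimately have evD: "\<forall>\<^sub>F z in at a. D z > 0"
    by (simp add: isCont_def order_tendstoD(1))
  have "isCont (\<lambda>w. cmod ((w - a) ^ Suc m * g1 w)) a"
    using cont[OF hol1] by (intro continuous_intros)
  then have ev1: "\<forall>\<^sub>F z in at a. cmod ((z - a) ^ Suc m * g1 z) < 1"
    by (simp add: isCont_def order_tendstoD(2))
  have evr: "\<forall>\<^sub>F z in at a. z \<in> ball a r - {a}"
    using r(1) by (intro eventually_at_in_open) auto
  from evD ev1 evr show ?thesis
  proof eventually_elim
    case (elim z)
    then have z: "z \<in> ball a r" "z \<noteq> a" by auto
    have "2 * F z * (deriv ^^ 2) F z - (deriv F z)\<^sup>2
        = ((z - a) ^ Suc m)\<^sup>2 * (2 * g z * g2 z - (g1 z)\<^sup>2)"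
      unfolding Fg[OF z(1)] F1[OF z(1)] F2[OF z(1)] m
      by (simp add: algebra_simps power2_eq_square)
    then have "cmod (2 * F z * (deriv ^^ 2) F z - (deriv F z)\<^sup>2)
        = (cmod ((z - a) ^ Suc m))\<^sup>2 * cmod (2 * g z * g2 z - (g1 z)\<^sup>2)"
      by (simp only: norm_mult norm_power)
    also have "\<dots> < (cmod ((z - a) ^ Suc m))\<^sup>2 * (cmod (g1 z))\<^sup>2"
      using elim(1) z(2) by (intro mult_strict_left_mono) (auto simp: D_def)
    also have "\<dots> = (cmod (deriv F z))\<^sup>2"
      by (simp only: F1[OF z(1)] norm_mult power_mult_distrib)
    finally show ?case using elim(2) z g0[OF z(1)] Fg[OF z(1)] F1[OF z(1)] by simp
  qed
qed

lemma modular_curvature_negative: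
  assumes "F analytic_on {z}" and "F z \<noteq> 0" and "cmod (deriv F z) \<noteq> 1"
    and less: "cmod (2 * F z * (deriv ^^ 2) F z - (deriv F z)\<^sup>2) < (cmod (deriv F z))\<^sup>2"
  shows "\<exists>K. modular_curvature F z = Some K \<and> K < 0"
proof -
  have "(cmod (2 * F z * (deriv ^^ 2) F z - (deriv F z)\<^sup>2))\<^sup>2 < ((cmod (deriv F z))\<^sup>2)\<^sup>2"
    using less by (intro power_strict_mono) auto
  then have num: "0 < (cmod (deriv F z)) ^ 4
      - (cmod (2 * F z * (deriv ^^ 2) F z - (deriv F z)\<^sup>2))\<^sup>2"
    by simp
  have "(cmod (deriv F z))\<^sup>2 \<noteq> 1"
    using assms(3) by (smt (verit) norm_ge_zero power2_eq_1_iff)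
  then have den: "0 < 4 * (cmod (F z))\<^sup>2 * (1 - (cmod (deriv F z))\<^sup>2)\<^sup>2"
    using assms(2) by simp
  show ?thesis
    unfolding modular_curvature_eq_quotient[OF assms(1-3)] modular_curvature_quotient_def Let_def
    using divide_pos_pos[OF num den] den by auto
qed

theorem proposition3p3:
  fixes n :: nat and F :: "complex \<Rightarrow> complex" and U :: "complex set"
  assumes "n \<ge> 3"
    and "open U" and "0 \<in> U" and "F analytic_on U"
    and "\<forall>k<n. (deriv ^^ k) F 0 = 0"
    and "(deriv ^^ n) F 0 \<noteq> 0"
  shows "modular_curvature_quotient F 0 = None \<and>
    (\<exists>V. open V \<and> 0 \<in> V \<and> V \<subseteq> U \<and>
      (\<forall>z\<in>V - {0}. \<exists>K. modular_curvature F z = Some K \<and> K < 0))"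
proof
  have "F 0 = 0" using assms(1,5) by (metis funpow_0 not_numeral_le_zero gr0I)
  then show "modular_curvature_quotient F 0 = None"
    by (simp add: modular_curvature_quotient_def)
next
  have "F analytic_on {0}" using assms(3,4) analytic_on_subset by blast
  then have "\<forall>\<^sub>F z in at 0. F z \<noteq> 0 \<and> cmod (deriv F z) < 1 \<and>
      cmod (2 * F z * (deriv ^^ 2) F z - (deriv F z)\<^sup>2) < (cmod (deriv F z))\<^sup>2"
    using assms(1,5,6) by (intro eventually_hessian_less_at_zero[of F 0 n]) auto
  then obtain S where S: "open S" "0 \<in> S"
    and neg: "\<And>z. z \<in> S \<Longrightarrow> z \<noteq> 0 \<Longrightarrow> F z \<noteq> 0 \<and> cmod (deriv F z) < 1 \<and>
      cmod (2 * F z * (deriv ^^ 2) F z - (deriv F z)\<^sup>2) < (cmod (deriv F z))\<^sup>2"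
    unfolding eventually_at_topological by blast
  have "\<exists>K. modular_curvature F z = Some K \<and> K < 0" if "z \<in> (S \<inter> U) - {0}" for z
  proof (rule modular_curvature_negative)
    show "F analytic_on {z}" using that assms(4) analytic_on_subset by blast
  qed (use that neg[of z] in auto)
  then show "\<exists>V. open V \<and> 0 \<in> V \<and> V \<subseteq> U \<and>
      (\<forall>z\<in>V - {0}. \<exists>K. modular_curvature F z = Some K \<and> K < 0)"
    using S assms(2,3) by (intro exI[of _ "S \<inter> U"]) auto
qed

end
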